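(* Let $G$ be a locally compact abelian group, $\gamma\in\Gamma$, $s\ge0$, and let $\alpha>s$ be such that $\xi\mapsto(1+\gamma(\xi)^2)^{-1}$ belongs to $L^\alpha(G^\wedge,\mu_{G^\wedge})$. Put $\alpha^*=\frac{2\alpha}{\alpha-s}$. Then $H^s_\gamma(G)\hookrightarrow L^{\alpha^*}_{\mu_G}(G)$: there is a constant $D(\gamma,s)$ such that every $f\in H^s_\gamma(G)$ lies in $L^{\alpha^*}_{\mu_G}(G)$ and \[ \|f\|_{L^{\alpha^*}_{\mu_G}(G)}\le D(\gamma,s)\,\|f\|_{H^s_\gamma(G)}. \]
   Context: $G$ is a locally compact abelian group with Haar measure $\mu_G$; $G^\wedge$ is its dual group (continuous homomorphisms $G\to\{z\in\mathbb C:|z|=1\}$, a locally compact abelian group under pointwise multiplication) with Haar measure $\mu_{G^\wedge}$ normalized so that the Plancherel theorem and Fourier inversion hold. For $f\in L^1_{\mu_G}(G)$, $\hat f(\xi)=\int_G\overline{\xi(x)}f(x)\,d\mu_G(x)$, extended to $L^2$ by Plancherel. $\Gamma$ is the set of functions $\gamma:G^\wedge\to[0,\infty)$ for which there is a constant $c_\gamma$ with $\gamma(\alpha\beta)\le c_\gamma[\gamma(\alpha)+\gamma(\beta)]$ for all $\alpha,\beta\in G^\wedge$. For $\gamma\in\Gamma$ and real $s\ge0$, $H^s_\gamma(G)$ is the set of $f\in L^2_{\mu_G}(G)$ with $\|f\|_{H^s_\gamma(G)}=\left(\int_{G^\wedge}(1+\gamma(\xi)^2)^s|\hat f(\xi)|^2\,d\mu_{G^\wedge}(\xi)\right)^{1/2}<\infty$.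 *)

theory Defs
  imports "HOL-Analysis.Analysis"
begin

definition borel_of_top :: "'a topology \<Rightarrow> 'a measure" where
  "borel_of_top X = sigma (topspace X) {U. openin X U}"

definition haar_measure_on ::
  "'a topology \<Rightarrow> ('a \<Rightarrow> 'a \<Rightarrow> 'a) \<Rightarrow> 'a measure \<Rightarrow> bool" where
  "haar_measure_on X gmul M \<longleftrightarrow>
     space M = topspace X \<and> sets M = sets (borel_of_top X) \<and>
     emeasure M (topspace X) \<noteq> 0 \<and>
     (\<forall>K. compactin X K \<longrightarrow> emeasure M K < \<infinity>) \<and>
     (\<forall>A \<in> sets M. emeasure M A = (INF U \<in> {U. openin X U \<and> A \<subseteq> U}. emeasure M U)) \<and>
     (\<forall>U. openin X U \<longrightarrow> emeasure M U = (SUP K \<in> {K. compactin X K \<and> K \<subseteq> U}. emeasure M K)) \<and>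
     (\<forall>x \<in> topspace X. \<forall>A \<in> sets M.
        (gmul x) ` A \<in> sets M \<and> emeasure M ((gmul x) ` A) = emeasure M A)"

definition dual_group :: "('g::{topological_space, ab_group_add} \<Rightarrow> complex) set" where
  "dual_group = {ch. continuous_on UNIV ch \<and> (\<forall>x y. ch (x + y) = ch x * ch y)
                      \<and> (\<forall>x. cmod (ch x) = 1)}"

definition dual_mult :: "('g \<Rightarrow> complex) \<Rightarrow> ('g \<Rightarrow> complex) \<Rightarrow> ('g \<Rightarrow> complex)" where
  "dual_mult \<alpha> \<beta> = (\<lambda>x. \<alpha> x * \<beta> x)"

text \<open>The compact-open topology on the dual group: generated by the sets
 \<open>{ch \<in> dual. ch ` K \<subseteq> U}\<close>, K compact in G, U open in the circle (equivalently in C).\<close>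

definition dual_topology :: "('g::{topological_space, ab_group_add} \<Rightarrow> complex) topology" where
  "dual_topology = topology_generated_by
     (insert dual_group
       {{ch \<in> dual_group. ch ` K \<subseteq> U} | K U. compact K \<and> open (U :: complex set)})"

definition in_Lp :: "'a measure \<Rightarrow> real \<Rightarrow> ('a \<Rightarrow> complex) \<Rightarrow> bool" where
  "in_Lp M p f \<longleftrightarrow> f \<in> borel_measurable M \<and> integrable M (\<lambda>x. cmod (f x) powr p)"

definition Lp_norm :: "'a measure \<Rightarrow> real \<Rightarrow> ('a \<Rightarrow> complex) \<Rightarrow> real" where
  "Lp_norm M p f = (\<integral>x. cmod (f x) powr p \<partial>M) powr (1 / p)"

definition fourier_L1 :: "'g measure \<Rightarrow> ('g \<Rightarrow> complex) \<Rightarrow> ('g \<Rightarrow> complex) \<Rightarrow> complex" where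
  "fourier_L1 M f \<xi> = (\<integral>x. cnj (\<xi> x) * f x \<partial>M)"

definition plancherel_normalized :: "'g measure \<Rightarrow> ('g \<Rightarrow> complex) measure \<Rightarrow> bool" where
  "plancherel_normalized M N \<longleftrightarrow>
     (\<forall>f. in_Lp M 1 f \<and> in_Lp M 2 f \<longrightarrow>
        in_Lp N 2 (fourier_L1 M f) \<and>
        (\<integral>\<xi>. cmod (fourier_L1 M f \<xi>) ^ 2 \<partial>N) = (\<integral>x. cmod (f x) ^ 2 \<partial>M))"

text \<open>F is (a representative of) the \<open>L^2\<close> Fourier transform of \<open>f \<in> L^2\<close>, i.e. the
 extension by Plancherel: the \<open>L^2(N)\<close>-limit of the Fourier transforms of any
 sequence in \<open>L^1 \<inter> L^2\<close> converging to f in \<open>L^2(M)\<close>.\<close>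

definition fourier_L2 ::
  "'g measure \<Rightarrow> ('g \<Rightarrow> complex) measure \<Rightarrow> ('g \<Rightarrow> complex) \<Rightarrow> (('g \<Rightarrow> complex) \<Rightarrow> complex) \<Rightarrow> bool" where
  "fourier_L2 M N f F \<longleftrightarrow> in_Lp M 2 f \<and> in_Lp N 2 F \<and>
     (\<exists>u::nat \<Rightarrow> 'g \<Rightarrow> complex. (\<forall>n. in_Lp M 1 (u n) \<and> in_Lp M 2 (u n)) \<and>
        (\<lambda>n. \<integral>x. cmod (u n x - f x) ^ 2 \<partial>M) \<longlonglongrightarrow> 0 \<and>
        (\<lambda>n. \<integral>\<xi>. cmod (fourier_L1 M (u n) \<xi> - F \<xi>) ^ 2 \<partial>N) \<longlonglongrightarrow> 0)"

definition Gamma_class :: "(('g::{topological_space, ab_group_add} \<Rightarrow> complex) \<Rightarrow> real) \<Rightarrow> bool" where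
  "Gamma_class \<gamma> \<longleftrightarrow> (\<forall>\<xi> \<in> dual_group. \<gamma> \<xi> \<ge> 0) \<and>
     (\<exists>c. \<forall>\<alpha> \<in> dual_group. \<forall>\<beta> \<in> dual_group. \<gamma> (dual_mult \<alpha> \<beta>) \<le> c * (\<gamma> \<alpha> + \<gamma> \<beta>))"

text \<open>Integrand of the squared \<open>H^s_\<gamma>\<close> norm, in terms of the Fourier transform F.\<close>

definition sobolev_weight :: "(('g \<Rightarrow> complex) \<Rightarrow> real) \<Rightarrow> real \<Rightarrow> (('g \<Rightarrow> complex) \<Rightarrow> complex) \<Rightarrow> ('g \<Rightarrow> complex) \<Rightarrow> real" where
  "sobolev_weight \<gamma> s F \<xi> = (1 + (\<gamma> \<xi>)\<^sup>2) powr s * (cmod (F \<xi>))\<^sup>2"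

end

theory Submission
  imports Defs
begin

text \<open>Put \<open>p = 2\<alpha> / (\<alpha> + s)\<close>, the exponent conjugate to \<open>q = \<alpha>\<^sup>* = 2\<alpha> / (\<alpha> - s)\<close>. By Hoelder's
  inequality the \<open>L\<^sup>p\<close> norm of the Fourier transform \<open>F\<close> of \<open>f\<close> is at most a power of the
  \<open>L\<^sup>\<alpha>\<close> norm of the weight \<open>(1 + \<gamma>\<^sup>2)\<^sup>-\<^sup>1\<close> times the Sobolev norm of \<open>f\<close>. For \<open>s > 0\<close> the
  Hausdorff-Young inequality, needed only up to a constant, comes from Marcinkiewicz interpolation
  between the \<open>L\<^sup>1\<close>-\<open>L\<^sup>\<infinity>\<close> bound and Plancherel for the forward transform. Testing \<open>f\<close> against
  truncations of \<open>|f|\<^sup>q\<^sup>-\<^sup>2 f\<close> then bounds the \<open>L\<^sup>q\<close> norm of \<open>f\<close> by the \<open>L\<^sup>p\<close> norm of \<open>F\<close>.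
  For \<open>s = 0\<close> the claim is Plancherel's theorem.\<close>

section \<open>Integrability in Lp, the Hoelder inequality and limits in L2\<close>

lemma in_Lp_1_iff: "in_Lp M 1 f \<longleftrightarrow> integrable M f"
  unfolding in_Lp_def by (auto simp: integrable_norm_iff dest: borel_measurable_integrable)

lemma in_Lp_2_iff: "in_Lp M 2 f \<longleftrightarrow> f \<in> borel_measurable M \<and> integrable M (\<lambda>x. (cmod (f x))\<^sup>2)"
  unfolding in_Lp_def by simp

text \<open>If one of the two norms vanishes, the product is 0 almost everywhere. Otherwise Young's
  inequality is applied to the factors divided by their norms, and integrating gives 1/p + 1/q = 1.
  Integrability is a separate conclusion because a Bochner integral defaults to 0, so that the bound
  alone could be empty.\<close>

lemma Holder_integral:
  fixes a b :: "'a \<Rightarrow> real"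
  assumes pq: "p > 1" "q > 1" "1 / p + 1 / q = 1"
    and meas [measurable]: "a \<in> borel_measurable M" "b \<in> borel_measurable M"
    and nonneg: "\<And>x. 0 \<le> a x" "\<And>x. 0 \<le> b x"
    and int_a: "integrable M (\<lambda>x. a x powr p)" and int_b: "integrable M (\<lambda>x. b x powr q)"
  shows "integrable M (\<lambda>x. a x * b x)"
    and "(\<integral>x. a x * b x \<partial>M) \<le> (\<integral>x. a x powr p \<partial>M) powr (1 / p) * (\<integral>x. b x powr q \<partial>M) powr (1 / q)"
proof -
  let ?A = "\<integral>x. a x powr p \<partial>M" and ?B = "\<integral>x. b x powr q \<partial>M"
  have Young: "a x * b x \<le> a x powr p / p + b x powr q / q" for x
    using Youngs_inequality[OF pq nonneg] .
  show int_ab: "integrable M (\<lambda>x. a x * b x)"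
  proof (rule Bochner_Integration.integrable_bound)
    show "integrable M (\<lambda>x. a x powr p / p + b x powr q / q)"
      using int_a int_b by simp
    show "AE x in M. norm (a x * b x) \<le> norm (a x powr p / p + b x powr q / q)"
      using Young nonneg pq by (auto intro!: AE_I2 order_trans[OF _ abs_ge_self])
  qed simp
  have A0: "?A \<ge> 0" and B0: "?B \<ge> 0"
    by simp_all
  show "(\<integral>x. a x * b x \<partial>M) \<le> ?A powr (1 / p) * ?B powr (1 / q)"
  proof (cases "?A = 0 \<or> ?B = 0")
    case True
    have "AE x in M. a x = 0 \<or> b x = 0"
    proof (cases "?A = 0")
      case True
      then have "AE x in M. a x powr p = 0"
        using integral_nonneg_eq_0_iff_AE[OF int_a] by simp
      then show ?thesis by eventually_elim simp
    next
      case False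
      with \<open>?A = 0 \<or> ?B = 0\<close> have "AE x in M. b x powr q = 0"
        using integral_nonneg_eq_0_iff_AE[OF int_b] by simp
      then show ?thesis by eventually_elim simp
    qed
    then have "(\<integral>x. a x * b x \<partial>M) = 0"
      by (intro integral_eq_zero_AE) auto
    then show ?thesis by simp
  next
    case False
    then have A: "?A > 0" and B: "?B > 0"
      using A0 B0 by linarith+
    let ?c = "?A powr (1 / p)" and ?d = "?B powr (1 / q)"
    have cd: "?c > 0" "?d > 0" "?c powr p = ?A" "?d powr q = ?B"
      using A B pq by (simp_all add: powr_powr)
    have "(\<integral>x. a x * b x \<partial>M) / (?c * ?d) = (\<integral>x. a x * b x / (?c * ?d) \<partial>M)"
      by simp
    also have "\<dots> \<le> (\<integral>x. a x powr p / (?A * p) + b x powr q / (?B * q) \<partial>M)"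
    proof (rule integral_mono)
      show "a x * b x / (?c * ?d) \<le> a x powr p / (?A * p) + b x powr q / (?B * q)" for x
        using Youngs_inequality[OF pq, of "a x / ?c" "b x / ?d"] cd nonneg[of x]
        by (simp add: powr_divide)
    qed (use int_ab int_a int_b in simp_all)
    also have "\<dots> = ?A / (?A * p) + ?B / (?B * q)"
      using int_a int_b by simp
    also have "\<dots> = 1"
      using A B pq by simp
    finally show ?thesis
      using cd(1,2) by (simp add: divide_le_eq)
  qed
qed

lemma in_L2_mult_integrable:
  assumes "in_Lp M 2 f" "in_Lp M 2 g"
  shows "integrable M (\<lambda>x. cmod (f x) * cmod (g x))"
    and "(\<integral>x. cmod (f x) * cmod (g x) \<partial>M) \<le> sqrt (\<integral>x. (cmod (f x))\<^sup>2 \<partial>M) * sqrt (\<integral>x. (cmod (g x))\<^sup>2 \<partial>M)"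
  using Holder_integral[of 2 2 "\<lambda>x. cmod (f x)" M "\<lambda>x. cmod (g x)"] assms
  by (auto simp: in_Lp_2_iff powr_half_sqrt)

lemma in_L2_add:
  assumes "in_Lp M 2 f" "in_Lp M 2 g"
  shows "in_Lp M 2 (\<lambda>x. f x + g x)"
proof -
  have [measurable]: "f \<in> borel_measurable M" "g \<in> borel_measurable M"
    using assms by (auto simp: in_Lp_2_iff)
  have "integrable M (\<lambda>x. (cmod (f x + g x))\<^sup>2)"
  proof (rule Bochner_Integration.integrable_bound)
    show "integrable M (\<lambda>x. (cmod (f x))\<^sup>2 + (cmod (g x))\<^sup>2 + 2 * (cmod (f x) * cmod (g x)))"
      using assms in_L2_mult_integrable[OF assms] by (simp add: in_Lp_2_iff)
    show "AE x in M. norm ((cmod (f x + g x))\<^sup>2)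
       \<le> norm ((cmod (f x))\<^sup>2 + (cmod (g x))\<^sup>2 + 2 * (cmod (f x) * cmod (g x)))"
    proof (rule AE_I2)
      fix x
      have "(cmod (f x + g x))\<^sup>2 \<le> (cmod (f x) + cmod (g x))\<^sup>2"
        by (simp add: norm_triangle_ineq power_mono)
      then show "norm ((cmod (f x + g x))\<^sup>2)
       \<le> norm ((cmod (f x))\<^sup>2 + (cmod (g x))\<^sup>2 + 2 * (cmod (f x) * cmod (g x)))"
        by (simp add: power2_sum)
    qed
  qed simp
  then show ?thesis by (simp add: in_Lp_2_iff)
qed

lemma in_L2_cmult:
  assumes "in_Lp M 2 f"
  shows "in_Lp M 2 (\<lambda>x. c * f x)"
  using assms by (auto simp: in_Lp_2_iff norm_mult power_mult_distrib)

lemma in_L2_diff: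
  assumes "in_Lp M 2 f" "in_Lp M 2 g"
  shows "in_Lp M 2 (\<lambda>x. f x - g x)"
  using in_L2_add[OF assms(1) in_L2_cmult[OF assms(2), of "-1"]] by simp

text \<open>Factoring the difference of squares bounds it pointwise by |u - f|^2 + 2 |f| |u - f|,
  and Cauchy-Schwarz controls the mixed term. This carries Plancherel's identity from an
  approximating sequence to its limit.\<close>

lemma L2_tendsto_integral_power2:
  assumes u: "\<And>n. in_Lp M 2 (u n)" and f: "in_Lp M 2 f"
    and lim: "(\<lambda>n. \<integral>x. (cmod (u n x - f x))\<^sup>2 \<partial>M) \<longlonglongrightarrow> 0"
  shows "(\<lambda>n. \<integral>x. (cmod (u n x))\<^sup>2 \<partial>M) \<longlonglongrightarrow> (\<integral>x. (cmod (f x))\<^sup>2 \<partial>M)"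
proof (rule LIM_zero_cancel)
  let ?d = "\<lambda>n. \<integral>x. (cmod (u n x - f x))\<^sup>2 \<partial>M" and ?S = "\<integral>x. (cmod (f x))\<^sup>2 \<partial>M"
  have d2: "in_Lp M 2 (\<lambda>x. u n x - f x)" for n
    using in_L2_diff u f .
  have bound: "norm ((\<integral>x. (cmod (u n x))\<^sup>2 \<partial>M) - ?S) \<le> ?d n + 2 * (sqrt ?S * sqrt (?d n))" for n
  proof -
    note int = u[of n] f d2[of n] in_L2_mult_integrable[OF f d2[of n]]
    have "norm ((\<integral>x. (cmod (u n x))\<^sup>2 \<partial>M) - ?S) = norm (\<integral>x. (cmod (u n x))\<^sup>2 - (cmod (f x))\<^sup>2 \<partial>M)"
      using int by (simp add: in_Lp_2_iff)
    also have "\<dots> \<le> (\<integral>x. \<bar>(cmod (u n x))\<^sup>2 - (cmod (f x))\<^sup>2\<bar> \<partial>M)"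
      using integral_norm_bound by (metis (no_types, lifting) Bochner_Integration.integral_cong real_norm_def)
    also have "\<dots> \<le> (\<integral>x. (cmod (u n x - f x))\<^sup>2 + 2 * (cmod (f x) * cmod (u n x - f x)) \<partial>M)"
    proof (rule integral_mono)
      fix x
      let ?a = "cmod (u n x)" and ?b = "cmod (f x)" and ?e = "cmod (u n x - f x)"
      have "\<bar>?a - ?b\<bar> \<le> ?e"
        by (rule norm_triangle_ineq3)
      moreover have "\<bar>?a + ?b\<bar> \<le> ?e + 2 * ?b"
        using norm_triangle_ineq2[of "u n x" "f x"] by simp
      ultimately have "\<bar>?a - ?b\<bar> * \<bar>?a + ?b\<bar> \<le> ?e * (?e + 2 * ?b)"
        by (intro mult_mono) auto
      then show "\<bar>?a\<^sup>2 - ?b\<^sup>2\<bar> \<le> ?e\<^sup>2 + 2 * (?b * ?e)"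
        unfolding abs_mult[symmetric] by (simp add: power2_eq_square algebra_simps)
    qed (use int in \<open>auto simp: in_Lp_2_iff\<close>)
    also have "\<dots> \<le> ?d n + 2 * (sqrt ?S * sqrt (?d n))"
      using int by (simp add: in_Lp_2_iff)
    finally show ?thesis .
  qed
  have "(\<lambda>n. ?d n + 2 * (sqrt ?S * sqrt (?d n))) \<longlonglongrightarrow> 0 + 2 * (sqrt ?S * sqrt 0)"
    by (intro tendsto_intros lim)
  then have lim0: "(\<lambda>n. ?d n + 2 * (sqrt ?S * sqrt (?d n))) \<longlonglongrightarrow> 0"
    by simp
  show "(\<lambda>n. (\<integral>x. (cmod (u n x))\<^sup>2 \<partial>M) - ?S) \<longlonglongrightarrow> 0"
    by (rule Lim_null_comparison[OF always_eventually[rule_format, OF bound] lim0])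
qed

section \<open>Marcinkiewicz interpolation over dyadic levels\<close>

text \<open>The surviving terms form a tail of a geometric progression of ratio
  \<open>\<theta> powr r\<close> whose largest member is at most \<open>A powr r\<close>. The
  induction replaces \<open>L\<close> by \<open>L * \<theta>\<close> while \<open>L\<close> exceeds
  \<open>A\<close>; once \<open>L \<le> A\<close> the whole series is summed. The bound depends
  neither on the starting level nor on the number of terms.\<close>

lemma geometric_level_sum_bound:
  fixes A L r \<theta> :: real
  assumes A: "A > 0" and r: "r > 0" and \<theta>: "0 < \<theta>" "\<theta> < 1" and L: "L > 0"
  shows "(\<Sum>n<K. if L * \<theta> ^ n \<le> A then (L * \<theta> ^ n) powr r else 0) \<le> A powr r / (1 - \<theta> powr r)"
  using L
proof (induction K arbitrary: L)
  case 0
  have "\<theta> powr r < 1"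
    using \<theta> r by (simp add: powr01_less_one)
  then show ?case by simp
next
  case (Suc K)
  have \<theta>r: "\<theta> powr r < 1"
    using \<theta> r by (simp add: powr01_less_one)
  show ?case
  proof (cases "L \<le> A")
    case True
    have "(\<Sum>n<Suc K. if L * \<theta> ^ n \<le> A then (L * \<theta> ^ n) powr r else 0)
       \<le> (\<Sum>n<Suc K. L powr r * (\<theta> powr r) ^ n)"
    proof (rule sum_mono)
      fix n
      have "(\<theta> ^ n) powr r = (\<theta> powr r) ^ n"
        using \<theta> by (simp add: powr_power[symmetric] powr_realpow[symmetric] powr_powr mult.commute)
      then show "(if L * \<theta> ^ n \<le> A then (L * \<theta> ^ n) powr r else 0) \<le> L powr r * (\<theta> powr r) ^ n"
        using \<theta> Suc.prems by (simp add: powr_mult)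
    qed
    also have "\<dots> = L powr r * ((1 - (\<theta> powr r) ^ Suc K) / (1 - \<theta> powr r))"
      using \<theta>r by (simp only: sum_distrib_left[symmetric] sum_gp_strict) simp
    also have "\<dots> \<le> L powr r * (1 / (1 - \<theta> powr r))"
      using \<theta>r by (intro mult_left_mono divide_right_mono) auto
    also have "\<dots> \<le> A powr r / (1 - \<theta> powr r)"
      using True Suc.prems \<theta>r r by (simp add: divide_right_mono powr_mono2)
    finally show ?thesis .
  next
    case False
    have "(\<Sum>n<Suc K. if L * \<theta> ^ n \<le> A then (L * \<theta> ^ n) powr r else 0)
       = (\<Sum>n<K. if (L * \<theta>) * \<theta> ^ n \<le> A then ((L * \<theta>) * \<theta> ^ n) powr r else 0)"
      using False by (subst sum.lessThan_Suc_shift) (simp add: mult.assoc cong: if_cong)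
    then show ?thesis
      using Suc.IH[of "L * \<theta>"] Suc.prems \<theta> by simp
  qed
qed

lemma Lp_truncations:
  fixes g :: "'a \<Rightarrow> complex"
  assumes g: "in_Lp M 1 g" "in_Lp M 2 g" and P: "Measurable.pred M P"
  shows "in_Lp M 1 (\<lambda>x. if P x then g x else 0)" "in_Lp M 2 (\<lambda>x. if P x then g x else 0)"
proof -
  note [measurable] = P
  have [measurable]: "g \<in> borel_measurable M"
    using g by (simp add: in_Lp_def)
  show "in_Lp M 1 (\<lambda>x. if P x then g x else 0)"
    unfolding in_Lp_1_iff
    by (rule Bochner_Integration.integrable_bound[of _ g]) (use g in \<open>auto simp: in_Lp_1_iff\<close>)
  have "integrable M (\<lambda>x. (cmod (if P x then g x else 0))\<^sup>2)"
    by (rule Bochner_Integration.integrable_bound[of _ "\<lambda>x. (cmod (g x))\<^sup>2"])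
      (use g in \<open>auto simp: in_Lp_2_iff\<close>)
  then show "in_Lp M 2 (\<lambda>x. if P x then g x else 0)"
    by (simp add: in_Lp_2_iff)
qed

text \<open>Pointwise, \<open>a powr p\<close> is at most \<open>a\<close> for
  \<open>a \<le> 1\<close> and at most the square of \<open>a\<close> beyond.\<close>

lemma in_Lp_between:
  assumes g: "in_Lp M 1 g" "in_Lp M 2 g" and p: "1 \<le> p" "p \<le> 2"
  shows "in_Lp M p g"
proof -
  have [measurable]: "g \<in> borel_measurable M"
    using g by (simp add: in_Lp_def)
  have "integrable M (\<lambda>x. cmod (g x) powr p)"
  proof (rule Bochner_Integration.integrable_bound)
    show "integrable M (\<lambda>x. cmod (g x) + (cmod (g x))\<^sup>2)"
      using g by (simp add: in_Lp_1_iff in_Lp_2_iff)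
    have "a powr p \<le> a + a\<^sup>2" if "a \<ge> 0" for a :: real
    proof (cases "a \<le> 1")
      case True
      then have "a powr p \<le> a powr 1"
        using p that powr_mono'[of 1 p a] by simp
      then show ?thesis using that by (simp add: add_increasing2)
    next
      case False
      then have "a powr p \<le> a powr 2"
        using p by (intro powr_mono) auto
      then show ?thesis using that by (simp add: add_increasing)
    qed
    then show "AE x in M. norm (cmod (g x) powr p) \<le> norm (cmod (g x) + (cmod (g x))\<^sup>2)"
      by (auto intro!: AE_I2)
  qed simp
  then show ?thesis by (simp add: in_Lp_def)
qed

lemma suminf_ennreal_le:
  fixes f :: "nat \<Rightarrow> real"
  assumes "\<And>n. 0 \<le> f n" and "\<And>K. (\<Sum>n<K. f n) \<le> C"
  shows "(\<Sum>n. ennreal (f n)) \<le> ennreal C"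
  by (rule suminf_le_const) (use assms in \<open>auto simp: sum_ennreal intro: ennreal_leI\<close>)

lemma le_suminf_ennreal:
  fixes f :: "nat \<Rightarrow> ennreal"
  shows "f n \<le> (\<Sum>n. f n)"
  using sum_le_suminf[OF summableI[of f], of "{n}"] by simp

lemma conjugate_exponents:
  fixes p q :: real
  assumes pq: "1 / p + 1 / q = 1" and p: "1 < p"
  shows "p * q = p + q" and "p < 2 \<Longrightarrow> 2 < q"
proof -
  show *: "p * q = p + q"
    using pq p by (cases "q = 0") (auto simp: field_simps)
  have "q = p / (p - 1)"
    using * p by (simp add: field_simps)
  then show "p < 2 \<Longrightarrow> 2 < q"
    using p by (simp add: less_divide_eq)
qed

text \<open>The numerator is \<open>4 * 2 powr q * 2 powr (q - 2)\<close>: the first two factors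
  come from the weights of the dyadic levels, the third from the 2 in the truncation threshold. The
  denominator sums a geometric series of ratio \<open>(1 / 2) powr (q - 2)\<close>, which converges
  for \<open>q > 2\<close>.\<close>

definition interpolation_const :: "real \<Rightarrow> real" where
  "interpolation_const q = 2 powr (2 * q) / (1 - (1 / 2) powr (q - 2))"

lemma interpolation_const_pos: "q > 2 \<Longrightarrow> interpolation_const q > 0"
  using powr01_less_one[of "1 / 2 :: real" "q - 2"] by (simp add: interpolation_const_def)

text \<open>The interpolation is carried out over dyadic levels instead of by the layer cake formula, since
  the latter needs Fubini and Haar measure need not be \<open>\<sigma>\<close>-finite.\<close>

lemma marcinkiewicz_nn_integral:
  fixes T :: "('a \<Rightarrow> complex) \<Rightarrow> 'b \<Rightarrow> complex" and p q :: real
  assumes p: "1 < p" "p < 2" and pq: "1 / p + 1 / q = 1"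
    and add: "\<And>u v y. \<lbrakk>in_Lp M 1 u; in_Lp M 2 u; in_Lp M 1 v; in_Lp M 2 v; y \<in> space N\<rbrakk>
      \<Longrightarrow> T (\<lambda>x. u x + v x) y = T u y + T v y"
    and bounded: "\<And>u y. \<lbrakk>in_Lp M 1 u; in_Lp M 2 u; y \<in> space N\<rbrakk> \<Longrightarrow> cmod (T u y) \<le> (\<integral>x. cmod (u x) \<partial>M)"
    and L2: "\<And>u. in_Lp M 1 u \<Longrightarrow> in_Lp M 2 u \<Longrightarrow> in_Lp N 2 (T u)"
    and L2_le: "\<And>u. in_Lp M 1 u \<Longrightarrow> in_Lp M 2 u
      \<Longrightarrow> (\<integral>y. (cmod (T u y))\<^sup>2 \<partial>N) \<le> (\<integral>x. (cmod (u x))\<^sup>2 \<partial>M)"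
    and g: "in_Lp M 1 g" "in_Lp M 2 g"
  shows "(\<integral>\<^sup>+y. ennreal (cmod (T g y) powr q) \<partial>N)
    \<le> ennreal (interpolation_const q * (\<integral>x. cmod (g x) powr p \<partial>M) powr (q - 1))"
proof -
  define P where "P = (\<integral>x. cmod (g x) powr p \<partial>M)"
  define L where "L = (\<integral>x. cmod (g x) \<partial>M)"
  \<comment> \<open>\<open>L\<close> bounds |T g| everywhere, so the halving levels starting at
    \<open>L / 2\<close> put each nonzero value of |T g| into some interval from
    \<open>lev n\<close> (excluded) to \<open>2 * lev n\<close>.\<close>
  define lev where "lev n = (L / 2) * (1 / 2) ^ n" for n :: nat
  \<comment> \<open>Where |g| exceeds \<open>t n\<close>, it is at most |g|^p divided by
    \<open>t n powr (p - 1)\<close>, which is \<open>2 * P / lev n\<close>. Hence the part of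
    \<open>g\<close> above the threshold has L1 norm at most \<open>lev n / 2\<close>, and so does
    its transform in supremum norm.\<close>
  define t where "t n = (2 * P / lev n) powr (1 / (p - 1))" for n
  define lo where "lo n x = (if cmod (g x) \<le> t n then g x else 0)" for n x
  define hi where "hi n x = (if \<not> cmod (g x) \<le> t n then g x else 0)" for n x
  define C where "C = 4 * 2 powr q * 2 powr (q - 2) / (1 - (1 / 2) powr (q - 2))"
  note pq' = conjugate_exponents(1)[OF pq p(1)]
  note q = conjugate_exponents(2)[OF pq p]
  have C_eq: "C = interpolation_const q"
  proof -
    have "4 * 2 powr q * 2 powr (q - 2) = (2::real) powr (2 * q)"
      by (simp add: powr_diff) (simp add: powr_add[symmetric])
    then show ?thesis
      by (simp add: C_def interpolation_const_def)
  qed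
  have [measurable]: "g \<in> borel_measurable M"
    using g by (simp add: in_Lp_def)
  have int_p: "integrable M (\<lambda>x. cmod (g x) powr p)"
    using in_Lp_between[OF g, of p] p by (simp add: in_Lp_def)
  have int_1: "integrable M (\<lambda>x. cmod (g x))"
    using g by (simp add: in_Lp_1_iff)
  have "P \<ge> 0" "L \<ge> 0"
    by (simp_all add: P_def L_def)
  show ?thesis
  proof (cases "L = 0")
    case True
    then have "T g y = 0" if "y \<in> space N" for y
      using bounded[OF g that] by (simp add: L_def)
    then have "(\<integral>\<^sup>+y. ennreal (cmod (T g y) powr q) \<partial>N) = 0"
      by (subst nn_integral_cong[of _ _ "\<lambda>_. 0"]) auto
    then show ?thesis by simp
  next
    case False
    with \<open>L \<ge> 0\<close> have L: "L > 0" by simp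
    have "P \<noteq> 0"
    proof
      assume "P = 0"
      then have "AE x in M. cmod (g x) powr p = 0"
        using integral_nonneg_eq_0_iff_AE[OF int_p] by (simp add: P_def)
      then have "L = 0"
        unfolding L_def by (intro integral_eq_zero_AE) auto
      with L show False by simp
    qed
    with \<open>P \<ge> 0\<close> have P: "P > 0" by simp
    have lev: "lev n > 0" for n
      using L by (simp add: lev_def)
    have t: "t n > 0" for n
      using P lev[of n] by (simp add: t_def)
    have t_powr: "t n powr (p - 1) = 2 * P / lev n" for n
      using P lev[of n] p by (simp add: t_def powr_powr)
    have g_split: "g = (\<lambda>x. lo n x + hi n x)" for n
      by (auto simp: lo_def hi_def)
    have lo: "in_Lp M 1 (lo n)" "in_Lp M 2 (lo n)" for n
      using Lp_truncations[OF g, of "\<lambda>x. cmod (g x) \<le> t n"] by (simp_all add: lo_def[abs_def])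
    have hi: "in_Lp M 1 (hi n)" "in_Lp M 2 (hi n)" for n
      using Lp_truncations[OF g, of "\<lambda>x. \<not> cmod (g x) \<le> t n"] by (simp_all add: hi_def[abs_def])
    have [measurable]: "T (lo n) \<in> borel_measurable N" for n
      using L2[OF lo] by (simp add: in_Lp_def)
    have [measurable]: "lo n \<in> borel_measurable M" for n
      using lo by (simp add: in_Lp_def)
    have hi_small: "(\<integral>x. cmod (hi n x) \<partial>M) \<le> lev n / 2" for n
    proof -
      have "(\<integral>x. cmod (hi n x) \<partial>M) \<le> (\<integral>x. lev n / (2 * P) * cmod (g x) powr p \<partial>M)"
      proof (rule integral_mono)
        fix x
        show "cmod (hi n x) \<le> lev n / (2 * P) * cmod (g x) powr p"
        proof (cases "cmod (g x) \<le> t n")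
          case True
          then show ?thesis using P lev[of n] by (simp add: hi_def)
        next
          case False
          then have pos: "cmod (g x) > 0" using t[of n] by linarith
          have "2 * P / lev n \<le> cmod (g x) powr (p - 1)"
            unfolding t_powr[symmetric] using False t[of n] p by (intro powr_mono2) auto
          then have "2 * P / lev n * cmod (g x) \<le> cmod (g x) powr (p - 1) * cmod (g x)"
            by (rule mult_right_mono) simp
          also have "\<dots> = cmod (g x) powr p"
            using pos by (simp add: powr_diff)
          finally show ?thesis
            using False P lev[of n] by (simp add: hi_def field_simps)
        qed
      qed (use hi int_p in \<open>auto simp: in_Lp_1_iff\<close>)
      also have "\<dots> = lev n / 2"
        using P by (simp add: P_def)
      finally show ?thesis .
    qed
    \<comment> \<open>Chosen so that \<open>w n * (lev n / 2)\<^sup>2\<close> equals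
      \<open>(2 * lev n) powr q\<close>: a lower bound \<open>lev n / 2\<close> for the transform of
      the low part then pays for a value of |T g| up to \<open>2 * lev n\<close>.\<close>
    define w where "w n = 4 * 2 powr q * lev n powr (q - 2)" for n
    have w: "w n \<ge> 0" for n
      by (simp add: w_def)
    have w_eq: "w n * (lev n / 2)\<^sup>2 = (2 * lev n) powr q" for n
    proof -
      have "lev n powr (q - 2) * (lev n)\<^sup>2 = lev n powr q"
        using lev[of n] by (simp add: powr_diff)
      then show ?thesis
        using lev[of n] by (simp add: w_def powr_mult power_divide)
    qed
    \<comment> \<open>One term of the series suffices. At the level with |T g y| between
      \<open>lev n\<close> and \<open>2 * lev n\<close>, the high part contributes at most
      \<open>lev n / 2\<close>, so the low part retains at least \<open>lev n / 2\<close>.\<close>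
    have upper: "ennreal (cmod (T g y) powr q) \<le> (\<Sum>n. ennreal (w n * (cmod (T (lo n) y))\<^sup>2))"
      if y: "y \<in> space N" for y
    proof (cases "T g y = 0")
      case False
      let ?b = "cmod (T g y)"
      have b: "0 < ?b" "?b \<le> L"
        using False bounded[OF g y] by (auto simp: L_def)
      obtain m where "(1 / 2 :: real) ^ m < ?b / L"
        using real_arch_pow_inv[of "?b / L" "1 / 2"] b L by auto
      then have "\<exists>m. L * (1 / 2) ^ m < ?b"
        using L by (auto simp: field_simps)
      then have *: "L * (1 / 2) ^ (LEAST m. L * (1 / 2) ^ m < ?b) < ?b"
        by (rule LeastI_ex)
      \<comment> \<open>The least \<open>k\<close> is positive since |T g y| is at most
        \<open>L\<close>. Its predecessor \<open>n\<close> is the level wanted, because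
        \<open>lev n\<close> already carries one extra halving and equals
        \<open>L * (1 / 2) ^ k\<close>.\<close>
      define k where "k = (LEAST m. L * (1 / 2) ^ m < ?b)"
      have "k \<noteq> 0"
        using * b by (auto simp: k_def[symmetric] intro!: Nat.gr0I)
      then obtain n where n: "k = Suc n"
        by (auto simp: gr0_conv_Suc)
      then have "\<not> L * (1 / 2) ^ n < ?b"
        using not_less_Least[of n "\<lambda>m. L * (1 / 2) ^ m < ?b"] by (simp add: k_def[symmetric])
      then have le: "?b \<le> 2 * lev n"
        by (simp add: lev_def)
      have gt: "lev n < ?b"
        using * by (simp add: k_def[symmetric] n lev_def)
      have "?b = cmod (T (lo n) y + T (hi n) y)"
        using add[OF lo hi y, of n n] by (simp add: g_split[of n, symmetric])
      also have "\<dots> \<le> cmod (T (lo n) y) + lev n / 2"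
        using norm_triangle_ineq[of "T (lo n) y" "T (hi n) y"] bounded[OF hi y, of n] hi_small[of n]
        by linarith
      finally have half: "lev n / 2 \<le> cmod (T (lo n) y)"
        using gt by linarith
      have "?b powr q \<le> (2 * lev n) powr q"
        using le q by (intro powr_mono2) auto
      also have "\<dots> \<le> w n * (cmod (T (lo n) y))\<^sup>2"
        unfolding w_eq[symmetric] using half lev[of n] w by (intro mult_left_mono power_mono) auto
      finally have "ennreal (?b powr q) \<le> ennreal (w n * (cmod (T (lo n) y))\<^sup>2)"
        by (rule ennreal_leI)
      also have "\<dots> \<le> (\<Sum>n. ennreal (w n * (cmod (T (lo n) y))\<^sup>2))"
        by (rule le_suminf_ennreal)
      finally show ?thesis .
    qed simp
    \<comment> \<open>At a point where \<open>g\<close> does not vanish, a nonzero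
      \<open>lo n x\<close> forces \<open>lev n \<le> ?A\<close>, so the sum over levels is
      geometric with exponent \<open>q - 2\<close>. The powers of |g x| combine to \<open>p\<close>
      because \<open>p * q = p + q\<close>.\<close>
    have lower: "(\<Sum>n. ennreal (w n * (cmod (lo n x))\<^sup>2))
      \<le> ennreal (C * P powr (q - 2) * cmod (g x) powr p)" for x
    proof (cases "g x = 0")
      case False
      let ?a = "cmod (g x)"
      let ?A = "2 * P * ?a powr (1 - p)"
      let ?r = "q - 2"
      have a: "?a > 0" using False by simp
      have A: "?A > 0" using a P by simp
      have active: "lev n \<le> ?A" if "?a \<le> t n" for n
      proof -
        have "?a powr (p - 1) \<le> 2 * P / lev n"
          unfolding t_powr[symmetric] using a that p by (intro powr_mono2) auto
        then have "lev n \<le> 2 * P / ?a powr (p - 1)"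
          using a lev[of n] by (simp add: field_simps)
        also have "\<dots> = ?A"
          using powr_minus_divide[of ?a "p - 1"] by simp
        finally show ?thesis .
      qed
      let ?c = "4 * 2 powr q * ?a\<^sup>2"
      have "(\<Sum>n<K. w n * (cmod (lo n x))\<^sup>2) \<le> C * P powr (q - 2) * ?a powr p" for K
      proof -
        have "(\<Sum>n<K. w n * (cmod (lo n x))\<^sup>2)
          \<le> (\<Sum>n<K. ?c * (if lev n \<le> ?A then lev n powr ?r else 0))"
          using active by (intro sum_mono) (auto simp: lo_def w_def)
        also have "\<dots> = ?c * (\<Sum>n<K. if lev n \<le> ?A then lev n powr ?r else 0)"
          by (simp only: sum_distrib_left)
        also have "\<dots> \<le> ?c * (?A powr ?r / (1 - (1 / 2) powr ?r))"
          unfolding lev_def using A q L by (intro mult_left_mono geometric_level_sum_bound) auto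
        also have "?c * (?A powr ?r / (1 - (1 / 2) powr ?r))
          = C * P powr (q - 2) * (?a powr ((1 - p) * (q - 2)) * ?a\<^sup>2)"
          using P a by (simp add: C_def powr_mult powr_powr)
        also have "?a powr ((1 - p) * (q - 2)) * ?a\<^sup>2 = ?a powr ((1 - p) * (q - 2) + 2)"
          using a by (simp add: powr_add)
        also have "(1 - p) * (q - 2) + 2 = p"
          using pq' by (simp add: algebra_simps)
        finally show ?thesis .
      qed
      then show ?thesis
        using w by (intro suminf_ennreal_le) auto
    next
      case True
      then have "lo n x = 0" for n
        by (simp add: lo_def)
      then show ?thesis by simp
    qed
    have each: "(\<integral>\<^sup>+y. ennreal (w n * (cmod (T (lo n) y))\<^sup>2) \<partial>N)
      \<le> (\<integral>\<^sup>+x. ennreal (w n * (cmod (lo n x))\<^sup>2) \<partial>M)" for n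
    proof -
      have "(\<integral>\<^sup>+y. ennreal (w n * (cmod (T (lo n) y))\<^sup>2) \<partial>N) = ennreal (\<integral>y. w n * (cmod (T (lo n) y))\<^sup>2 \<partial>N)"
        using L2[OF lo] w by (intro nn_integral_eq_integral) (auto simp: in_Lp_2_iff)
      also have "\<dots> \<le> ennreal (\<integral>x. w n * (cmod (lo n x))\<^sup>2 \<partial>M)"
        using L2_le[OF lo, of n] w by (auto intro!: ennreal_leI mult_left_mono)
      also have "\<dots> = (\<integral>\<^sup>+x. ennreal (w n * (cmod (lo n x))\<^sup>2) \<partial>M)"
        using lo w by (intro nn_integral_eq_integral[symmetric]) (auto simp: in_Lp_2_iff)
      finally show ?thesis .
    qed
    have "(\<integral>\<^sup>+y. ennreal (cmod (T g y) powr q) \<partial>N)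
      \<le> (\<integral>\<^sup>+y. (\<Sum>n. ennreal (w n * (cmod (T (lo n) y))\<^sup>2)) \<partial>N)"
      by (rule nn_integral_mono) (rule upper)
    \<comment> \<open>A countable sum of nonnegative functions commutes with the integral over any
      measure. Between the two exchanges the L2 bound is applied on each level separately.\<close>
    also have "\<dots> = (\<Sum>n. \<integral>\<^sup>+y. ennreal (w n * (cmod (T (lo n) y))\<^sup>2) \<partial>N)"
      by (rule nn_integral_suminf) measurable
    also have "\<dots> \<le> (\<Sum>n. \<integral>\<^sup>+x. ennreal (w n * (cmod (lo n x))\<^sup>2) \<partial>M)"
      by (intro suminf_le each) auto
    also have "\<dots> = (\<integral>\<^sup>+x. (\<Sum>n. ennreal (w n * (cmod (lo n x))\<^sup>2)) \<partial>M)"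
      by (rule nn_integral_suminf[symmetric]) measurable
    also have "\<dots> \<le> (\<integral>\<^sup>+x. ennreal (C * P powr (q - 2) * cmod (g x) powr p) \<partial>M)"
      by (rule nn_integral_mono) (rule lower)
    also have "\<dots> = ennreal (\<integral>x. C * P powr (q - 2) * cmod (g x) powr p \<partial>M)"
      using int_p interpolation_const_pos[OF q] by (intro nn_integral_eq_integral) (auto simp: C_eq)
    also have "(\<integral>x. C * P powr (q - 2) * cmod (g x) powr p \<partial>M) = C * (P powr (q - 2) * P)"
      by (simp add: P_def)
    also have "P powr (q - 2) * P = P powr (q - 1)"
      using P by (simp add: powr_mult_base mult.commute)
    finally show ?thesis
      by (simp add: C_eq P_def)
  qed
qed

section \<open>The Fourier transform on L1 and L2: Parseval and Hausdorff-Young\<close>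

lemma space_haar_dual:
  assumes "haar_measure_on dual_topology dual_mult \<nu>"
  shows "space \<nu> = dual_group"
  using assms by (auto simp: haar_measure_on_def dual_topology_def)

lemma sets_haar_euclidean:
  fixes \<mu> :: "'g::{topological_space, plus} measure"
  assumes "haar_measure_on euclidean (+) \<mu>"
  shows "sets \<mu> = sets borel"
  using assms by (simp add: haar_measure_on_def borel_of_top_def borel_def)

lemma fourier_L1_uminus: "fourier_L1 \<mu> (\<lambda>x. - u x) \<xi> = - fourier_L1 \<mu> u \<xi>"
  by (simp add: fourier_L1_def)

text \<open>\<open>sets_borel\<close> makes continuous characters measurable,
  \<open>space_dual\<close> makes every point of the space of \<open>\<nu>\<close> a unimodular
  character, and \<open>plancherel\<close> supplies the L2 endpoint of the interpolation.\<close>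

locale plancherel_pair =
  fixes \<mu> :: "'g::{topological_space, ab_group_add} measure"
    and \<nu> :: "('g \<Rightarrow> complex) measure"
  assumes sets_borel: "sets \<mu> = sets borel"
    and space_dual: "space \<nu> = dual_group"
    and plancherel: "plancherel_normalized \<mu> \<nu>"
begin

lemma fourier_L2_transform:
  assumes "in_Lp \<mu> 1 u" "in_Lp \<mu> 2 u"
  shows "in_Lp \<nu> 2 (fourier_L1 \<mu> u)"
    and "(\<integral>\<xi>. (cmod (fourier_L1 \<mu> u \<xi>))\<^sup>2 \<partial>\<nu>) = (\<integral>x. (cmod (u x))\<^sup>2 \<partial>\<mu>)"
  using plancherel assms by (auto simp: plancherel_normalized_def)

text \<open>The endpoint from L1 to bounded functions, by unimodularity of characters.\<close>

lemma norm_fourier_L1_le: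
  assumes "\<xi> \<in> space \<nu>"
  shows "cmod (fourier_L1 \<mu> u \<xi>) \<le> (\<integral>x. cmod (u x) \<partial>\<mu>)"
proof -
  have "cmod (\<xi> x) = 1" for x
    using assms by (simp add: space_dual dual_group_def)
  then show ?thesis
    unfolding fourier_L1_def
    using integral_norm_bound[of \<mu> "\<lambda>x. cnj (\<xi> x) * u x"] by (simp add: norm_mult)
qed

text \<open>Additivity of the Bochner integral requires both integrands to be integrable. A
  character is continuous, hence Borel, and unimodular, so multiplying by its conjugate preserves
  integrability.\<close>

lemma fourier_L1_add:
  assumes u: "in_Lp \<mu> 1 u" and v: "in_Lp \<mu> 1 v" and \<xi>: "\<xi> \<in> space \<nu>"
  shows "fourier_L1 \<mu> (\<lambda>x. u x + v x) \<xi> = fourier_L1 \<mu> u \<xi> + fourier_L1 \<mu> v \<xi>"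
proof -
  have norm: "cmod (\<xi> x) = 1" for x
    using \<xi> by (simp add: space_dual dual_group_def)
  have "continuous_on UNIV \<xi>"
    using \<xi> by (simp add: space_dual dual_group_def)
  then have [measurable]: "\<xi> \<in> borel_measurable \<mu>"
    using borel_measurable_continuous_onI measurable_cong_sets[OF sets_borel refl] by blast
  have [measurable]: "(\<lambda>x. cnj (\<xi> x)) \<in> borel_measurable \<mu>"
    by (rule borel_measurable_continuous_on[OF _ \<open>\<xi> \<in> borel_measurable \<mu>\<close>])
      (intro continuous_intros)
  have "integrable \<mu> (\<lambda>x. cnj (\<xi> x) * h x)" if "in_Lp \<mu> 1 h" for h
  proof (rule Bochner_Integration.integrable_bound[of _ h])
    show "integrable \<mu> h" using that by (simp add: in_Lp_1_iff)
    then have [measurable]: "h \<in> borel_measurable \<mu>" by simp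
    show "(\<lambda>x. cnj (\<xi> x) * h x) \<in> borel_measurable \<mu>" by measurable
  qed (simp add: norm_mult norm)
  from this[OF u] this[OF v] show ?thesis
    by (simp add: fourier_L1_def distrib_left)
qed

text \<open>Plancherel holds for each approximant, and the squared norms converge on both
  sides.\<close>

lemma fourier_L2_isometry:
  assumes "fourier_L2 \<mu> \<nu> f F"
  shows "(\<integral>\<xi>. (cmod (F \<xi>))\<^sup>2 \<partial>\<nu>) = (\<integral>x. (cmod (f x))\<^sup>2 \<partial>\<mu>)"
proof -
  obtain u where u: "\<And>n. in_Lp \<mu> 1 (u n)" "\<And>n. in_Lp \<mu> 2 (u n)"
    and lim: "(\<lambda>n. \<integral>x. cmod (u n x - f x) ^ 2 \<partial>\<mu>) \<longlonglongrightarrow> 0"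
      "(\<lambda>n. \<integral>\<xi>. cmod (fourier_L1 \<mu> (u n) \<xi> - F \<xi>) ^ 2 \<partial>\<nu>) \<longlonglongrightarrow> 0"
    and fF: "in_Lp \<mu> 2 f" "in_Lp \<nu> 2 F"
    using assms unfolding fourier_L2_def by blast
  show ?thesis
    using LIMSEQ_unique[OF L2_tendsto_integral_power2[OF fourier_L2_transform(1)[OF u] fF(2) lim(2)]]
      L2_tendsto_integral_power2[OF u(2) fF(1) lim(1)] fourier_L2_transform(2)[OF u]
    by simp
qed

text \<open>Adding \<open>g\<close> to every approximant leaves the differences from the limit
  unchanged. This makes the isometry available for the sum and difference of \<open>f\<close> and
  \<open>g\<close>.\<close>

lemma fourier_L2_add:
  assumes fF: "fourier_L2 \<mu> \<nu> f F" and g: "in_Lp \<mu> 1 g" "in_Lp \<mu> 2 g"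
  shows "fourier_L2 \<mu> \<nu> (\<lambda>x. f x + g x) (\<lambda>\<xi>. F \<xi> + fourier_L1 \<mu> g \<xi>)"
proof -
  obtain u where u: "\<And>n. in_Lp \<mu> 1 (u n)" "\<And>n. in_Lp \<mu> 2 (u n)"
    and lim: "(\<lambda>n. \<integral>x. cmod (u n x - f x) ^ 2 \<partial>\<mu>) \<longlonglongrightarrow> 0"
      "(\<lambda>n. \<integral>\<xi>. cmod (fourier_L1 \<mu> (u n) \<xi> - F \<xi>) ^ 2 \<partial>\<nu>) \<longlonglongrightarrow> 0"
    and L2: "in_Lp \<mu> 2 f" "in_Lp \<nu> 2 F"
    using fF unfolding fourier_L2_def by blast
  have "(\<integral>\<xi>. cmod (fourier_L1 \<mu> (\<lambda>x. u n x + g x) \<xi> - (F \<xi> + fourier_L1 \<mu> g \<xi>)) ^ 2 \<partial>\<nu>)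
      = (\<integral>\<xi>. cmod (fourier_L1 \<mu> (u n) \<xi> - F \<xi>) ^ 2 \<partial>\<nu>)" for n
    by (rule Bochner_Integration.integral_cong) (simp_all add: fourier_L1_add u g)
  with lim(2) have "(\<lambda>n. \<integral>\<xi>. cmod (fourier_L1 \<mu> (\<lambda>x. u n x + g x) \<xi> - (F \<xi> + fourier_L1 \<mu> g \<xi>)) ^ 2 \<partial>\<nu>)
      \<longlonglongrightarrow> 0"
    by simp
  moreover have "in_Lp \<mu> 1 (\<lambda>x. u n x + g x)" "in_Lp \<mu> 2 (\<lambda>x. u n x + g x)" for n
    using u g by (auto simp: in_Lp_1_iff intro: in_L2_add)
  ultimately show ?thesis
    unfolding fourier_L2_def using L2 g lim(1) fourier_L2_transform[OF g]
    by (intro conjI in_L2_add exI[of _ "\<lambda>n x. u n x + g x"]) auto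
qed

text \<open>Real polarization of the isometry, applied to the sum and difference of \<open>f\<close>
  and \<open>g\<close>. The inner product is the real one on the complex plane, which suffices for
  test functions that are nonnegative real multiples of \<open>f\<close>.\<close>

lemma parseval_inner:
  assumes fF: "fourier_L2 \<mu> \<nu> f F" and g: "in_Lp \<mu> 1 g" "in_Lp \<mu> 2 g"
  shows "(\<integral>x. f x \<bullet> g x \<partial>\<mu>) = (\<integral>\<xi>. F \<xi> \<bullet> fourier_L1 \<mu> g \<xi> \<partial>\<nu>)"
proof -
  have polar: "(\<integral>x. a x \<bullet> b x \<partial>M) = ((\<integral>x. (cmod (a x + b x))\<^sup>2 \<partial>M) - (\<integral>x. (cmod (a x - b x))\<^sup>2 \<partial>M)) / 4"
    if "in_Lp M 2 a" "in_Lp M 2 b" for a b and M :: "'c measure"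
  proof -
    have "a x \<bullet> b x = ((cmod (a x + b x))\<^sup>2 - (cmod (a x - b x))\<^sup>2) / 4" for x
      by (simp add: power2_norm_eq_inner inner_add inner_diff inner_commute)
    then have "(\<integral>x. a x \<bullet> b x \<partial>M) = (\<integral>x. ((cmod (a x + b x))\<^sup>2 - (cmod (a x - b x))\<^sup>2) / 4 \<partial>M)"
      by presburger
    also have "\<dots> = ((\<integral>x. (cmod (a x + b x))\<^sup>2 \<partial>M) - (\<integral>x. (cmod (a x - b x))\<^sup>2 \<partial>M)) / 4"
      using in_L2_add[OF that] in_L2_diff[OF that] by (simp add: in_Lp_2_iff)
    finally show ?thesis .
  qed
  have L2: "in_Lp \<mu> 2 f" "in_Lp \<nu> 2 F"
    using fF by (auto simp: fourier_L2_def)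
  have neg: "in_Lp \<mu> 1 (\<lambda>x. - g x)" "in_Lp \<mu> 2 (\<lambda>x. - g x)"
    using g in_L2_cmult[OF g(2), of "-1"] by (auto simp: in_Lp_1_iff)
  show ?thesis
    unfolding polar[OF L2(1) g(2)] polar[OF L2(2) fourier_L2_transform(1)[OF g]]
    using fourier_L2_isometry[OF fourier_L2_add[OF fF g]] fourier_L2_isometry[OF fourier_L2_add[OF fF neg]]
    by (simp add: fourier_L1_uminus)
qed

text \<open>Since \<open>p * (q - 1) = q\<close>, the right-hand power of the integral is the q-th
  power of the Lp norm of \<open>g\<close>, so this is Hausdorff-Young raised to the power
  \<open>q\<close>, with the interpolation constant in place of 1.\<close>

lemma hausdorff_young:
  assumes p: "1 < p" "p < 2" and pq: "1 / p + 1 / q = 1"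
    and g: "in_Lp \<mu> 1 g" "in_Lp \<mu> 2 g"
  shows "in_Lp \<nu> q (fourier_L1 \<mu> g)"
    and "(\<integral>\<xi>. cmod (fourier_L1 \<mu> g \<xi>) powr q \<partial>\<nu>)
      \<le> interpolation_const q * (\<integral>x. cmod (g x) powr p \<partial>\<mu>) powr (q - 1)"
proof -
  let ?B = "interpolation_const q * (\<integral>x. cmod (g x) powr p \<partial>\<mu>) powr (q - 1)"
  have nn: "(\<integral>\<^sup>+\<xi>. ennreal (cmod (fourier_L1 \<mu> g \<xi>) powr q) \<partial>\<nu>) \<le> ennreal ?B"
    by (rule marcinkiewicz_nn_integral[OF p pq])
      (simp_all add: fourier_L1_add norm_fourier_L1_le fourier_L2_transform g)
  have [measurable]: "fourier_L1 \<mu> g \<in> borel_measurable \<nu>"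
    using fourier_L2_transform(1)[OF g] by (simp add: in_Lp_def)
  have int: "integrable \<nu> (\<lambda>\<xi>. cmod (fourier_L1 \<mu> g \<xi>) powr q)"
    using nn by (intro integrableI_nonneg) (auto simp: less_top[symmetric] top_unique)
  then show "in_Lp \<nu> q (fourier_L1 \<mu> g)"
    by (simp add: in_Lp_def)
  have "?B \<ge> 0"
    using interpolation_const_pos[OF conjugate_exponents(2)[OF pq p]] by simp
  then show "(\<integral>\<xi>. cmod (fourier_L1 \<mu> g \<xi>) powr q \<partial>\<nu>) \<le> ?B"
    using nn nn_integral_eq_integral[OF int] by simp
qed

end

section \<open>The bound for the inverse transform, by duality and truncation\<close>

text \<open>Chebyshev's argument: on the support of \<open>h\<close> the function
  \<open>(c * cmod (f x))\<^sup>2\<close> is at least 1, so its multiples by \<open>B\<close> and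
  \<open>B\<^sup>2\<close> dominate |h| and |h|^2. This admits truncations of \<open>f\<close> as
  test functions.\<close>

lemma bounded_supported_in_L1_L2:
  fixes f h :: "'a \<Rightarrow> complex"
  assumes f: "in_Lp M 2 f" and meas [measurable]: "h \<in> borel_measurable M"
    and bound: "\<And>x. cmod (h x) \<le> B" and supp: "\<And>x. h x \<noteq> 0 \<Longrightarrow> 1 \<le> c * cmod (f x)" and B: "B \<ge> 0"
  shows "in_Lp M 1 h" "in_Lp M 2 h"
proof -
  have int_f: "integrable M (\<lambda>x. (c * cmod (f x))\<^sup>2)"
    using f by (simp add: in_Lp_2_iff power_mult_distrib)
  have ge: "1 \<le> (c * cmod (f x))\<^sup>2" if "h x \<noteq> 0" for x
    using supp[OF that] by (simp add: one_le_power)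
  have le: "a \<le> b * (c * cmod (f x))\<^sup>2" if "a \<le> b" "0 \<le> b" "h x \<noteq> 0" for a b x
    using mult_left_mono[OF ge[OF that(3)] that(2)] that(1) by simp
  have "integrable M h"
  proof (rule Bochner_Integration.integrable_bound)
    show "integrable M (\<lambda>x. B * (c * cmod (f x))\<^sup>2)" using int_f by simp
    have "cmod (h x) \<le> B * (c * cmod (f x))\<^sup>2" for x
      using le[OF bound B] B by (cases "h x = 0") auto
    then show "AE x in M. norm (h x) \<le> norm (B * (c * cmod (f x))\<^sup>2)"
      using B by (auto simp: abs_mult)
  qed simp
  then show "in_Lp M 1 h" by (simp add: in_Lp_1_iff)
  have "integrable M (\<lambda>x. (cmod (h x))\<^sup>2)"
  proof (rule Bochner_Integration.integrable_bound)
    show "integrable M (\<lambda>x. B\<^sup>2 * (c * cmod (f x))\<^sup>2)" using int_f by simp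
    have "(cmod (h x))\<^sup>2 \<le> B\<^sup>2 * (c * cmod (f x))\<^sup>2" for x
      using le[of "(cmod (h x))\<^sup>2" "B\<^sup>2" x] power_mono[OF bound norm_ge_zero, of x 2] by (cases "h x = 0") auto
    then show "AE x in M. norm ((cmod (h x))\<^sup>2) \<le> norm (B\<^sup>2 * (c * cmod (f x))\<^sup>2)"
      by auto
  qed simp
  then show "in_Lp M 2 h" by (simp add: in_Lp_2_iff)
qed

text \<open>Fatou's lemma, in the form that lets a bound uniform in the truncation level survive the
  limit.\<close>

lemma nn_integral_le_of_tendsto:
  fixes h :: "nat \<Rightarrow> 'a \<Rightarrow> real"
  assumes [measurable]: "\<And>n. h n \<in> borel_measurable M"
    and lim: "\<And>x. (\<lambda>n. h n x) \<longlonglongrightarrow> k x"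
    and bound: "\<And>n. (\<integral>\<^sup>+x. ennreal (h n x) \<partial>M) \<le> B"
  shows "(\<integral>\<^sup>+x. ennreal (k x) \<partial>M) \<le> B"
proof -
  have "liminf (\<lambda>n. ennreal (h n x)) = ennreal (k x)" for x
    by (intro lim_imp_Liminf tendsto_ennrealI lim) simp
  then have "(\<integral>\<^sup>+x. ennreal (k x) \<partial>M) = (\<integral>\<^sup>+x. liminf (\<lambda>n. ennreal (h n x)) \<partial>M)"
    by simp
  also have "\<dots> \<le> liminf (\<lambda>n. \<integral>\<^sup>+x. ennreal (h n x) \<partial>M)"
    by (rule nn_integral_liminf) measurable
  also have "\<dots> \<le> liminf (\<lambda>n::nat. B)"
    by (rule Liminf_mono) (simp add: bound)
  also have "\<dots> = B"
    by (rule Liminf_const) simp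
  finally show ?thesis .
qed

text \<open>The hypothesis \<open>plancherel_normalized\<close> does not say that the Fourier transform maps onto
  \<open>L\<^sup>2\<close> of the dual, so the inverse transform cannot be interpolated directly; the bound for it is
  obtained from the forward one by duality.\<close>

lemma (in plancherel_pair) hausdorff_young_inverse:
  assumes p: "1 < p" "p < 2" and pq: "1 / p + 1 / q = 1"
    and fF: "fourier_L2 \<mu> \<nu> f F" and F: "in_Lp \<nu> p F"
  shows "in_Lp \<mu> q f" and "Lp_norm \<mu> q f \<le> interpolation_const q powr (1 / q) * Lp_norm \<nu> p F"
proof -
  note pq' = conjugate_exponents(1)[OF pq p(1)]
  note q = conjugate_exponents(2)[OF pq p]
  let ?C = "interpolation_const q"
  note C = interpolation_const_pos[OF q]
  define K where "K = Lp_norm \<nu> p F"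
  have K: "K \<ge> 0" by (simp add: K_def Lp_norm_def)
  have f2: "in_Lp \<mu> 2 f" using fF by (simp add: fourier_L2_def)
  have [measurable]: "f \<in> borel_measurable \<mu>" using f2 by (simp add: in_Lp_def)
  have [measurable]: "F \<in> borel_measurable \<nu>" using F by (simp add: in_Lp_def)
  \<comment> \<open>The lower cutoff confines the test function to a set of finite measure and the
    upper one bounds it. These sets exhaust the support of \<open>f\<close> as \<open>n\<close>
    grows.\<close>
  define ok where "ok n x \<longleftrightarrow> 1 \<le> real (Suc n) * cmod (f x) \<and> cmod (f x) \<le> real (Suc n)" for n x
  have [measurable]: "Measurable.pred \<mu> (ok n)" for n
    unfolding ok_def[abs_def] by measurable
  \<comment> \<open>The truncated extremal function for the duality of Lq and Lp: both its inner
    product with \<open>f\<close> and the p-th power of its modulus equal the truncation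
    \<open>J n\<close> of |f|^q, since \<open>p * (q - 1) = q\<close>.\<close>
  define g where "g n x = (if ok n x then complex_of_real (cmod (f x) powr (q - 2)) * f x else 0)" for n x
  define J where "J n x = (if ok n x then cmod (f x) powr q else 0)" for n x
  have [measurable]: "g n \<in> borel_measurable \<mu>" "J n \<in> borel_measurable \<mu>" for n
    unfolding g_def[abs_def] J_def[abs_def] by measurable
  have norm_g: "cmod (g n x) = (if ok n x then cmod (f x) powr (q - 1) else 0)" for n x
  proof -
    have "a powr (q - 2) * a = a powr (q - 1)" if "a \<ge> 0" for a :: real
      using that q by (cases "a = 0") (auto simp: powr_mult_base mult.commute)
    then show ?thesis by (simp add: g_def norm_mult)
  qed
  have g: "in_Lp \<mu> 1 (g n)" "in_Lp \<mu> 2 (g n)" for n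
  proof -
    have bound: "cmod (g n x) \<le> real (Suc n) powr (q - 1)" for x
      unfolding norm_g using q by (auto simp: ok_def intro!: powr_mono2)
    have supp: "1 \<le> real (Suc n) * cmod (f x)" if "g n x \<noteq> 0" for x
      using that by (auto simp: g_def ok_def split: if_splits)
    show "in_Lp \<mu> 1 (g n)" "in_Lp \<mu> 2 (g n)"
      using bounded_supported_in_L1_L2[OF f2 _ bound supp] by simp_all
  qed
  have inner_g: "f x \<bullet> g n x = J n x" for n x
  proof (cases "ok n x")
    case True
    then have pos: "cmod (f x) > 0" by (auto simp: ok_def)
    have "f x \<bullet> g n x = cmod (f x) powr (q - 2) * (f x \<bullet> f x)"
      using True by (simp add: g_def scaleR_conv_of_real[symmetric])
    also have "f x \<bullet> f x = (cmod (f x))\<^sup>2"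
      by (simp add: power2_norm_eq_inner)
    finally show ?thesis
      using True pos by (simp add: J_def powr_diff)
  qed (simp add: g_def J_def)
  have g_powr: "cmod (g n x) powr p = J n x" for n x
    using pq' by (simp add: norm_g J_def powr_powr algebra_simps)
  have int_J: "integrable \<mu> (J n)" for n
    using in_Lp_between[OF g, of p n] p by (simp add: in_Lp_def g_powr)
  \<comment> \<open>Parseval, Hoelder and Hausdorff-Young bound the integral \<open>?I\<close> by
    \<open>K * (?C * ?I powr (q - 1)) powr (1 / q)\<close>. Raising to the power \<open>q\<close>
    and cancelling \<open>?I powr (q - 1)\<close> is legitimate because truncation makes
    \<open>?I\<close> a genuine finite integral, positive in this case.\<close>
  have J_le: "(\<integral>x. J n x \<partial>\<mu>) \<le> ?C * K powr q" for n
  proof (cases "(\<integral>x. J n x \<partial>\<mu>) = 0")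
    case True
    then show ?thesis using C by simp
  next
    case False
    let ?I = "\<integral>x. J n x \<partial>\<mu>" and ?G = "fourier_L1 \<mu> (g n)"
    have I: "?I > 0"
      using False Bochner_Integration.integral_nonneg[of \<mu> "J n"] by (simp add: J_def less_le)
    have G: "in_Lp \<nu> q ?G" and G_le: "(\<integral>\<xi>. cmod (?G \<xi>) powr q \<partial>\<nu>) \<le> ?C * ?I powr (q - 1)"
      using hausdorff_young[OF p pq g, of n] by (simp_all add: g_powr)
    have [measurable]: "?G \<in> borel_measurable \<nu>" using G by (simp add: in_Lp_def)
    note hold = Holder_integral[OF p(1) _ pq, of "\<lambda>\<xi>. cmod (F \<xi>)" \<nu> "\<lambda>\<xi>. cmod (?G \<xi>)"]
    have G_F: "integrable \<nu> (\<lambda>\<xi>. cmod (F \<xi>) * cmod (?G \<xi>))"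
      using hold(1) F G q by (simp add: in_Lp_def)
    have "?I = (\<integral>\<xi>. F \<xi> \<bullet> ?G \<xi> \<partial>\<nu>)"
      using parseval_inner[OF fF g, of n] by (simp add: inner_g)
    also have "\<dots> \<le> (\<integral>\<xi>. cmod (F \<xi>) * cmod (?G \<xi>) \<partial>\<nu>)"
    \<comment> \<open>This form asks for integrability of the larger, nonnegative function only; the
      smaller integral would otherwise default to 0.\<close>
    proof (rule integral_mono')
      show "F \<xi> \<bullet> ?G \<xi> \<le> cmod (F \<xi>) * cmod (?G \<xi>)" for \<xi>
        by (rule norm_cauchy_schwarz)
    qed (use G_F in auto)
    also have "\<dots> \<le> K * (\<integral>\<xi>. cmod (?G \<xi>) powr q \<partial>\<nu>) powr (1 / q)"
      using hold(2) F G q by (simp add: in_Lp_def K_def Lp_norm_def)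
    also have "\<dots> \<le> K * (?C * ?I powr (q - 1)) powr (1 / q)"
      using G_le K q by (intro mult_left_mono powr_mono2) auto
    finally have "?I powr q \<le> (K * (?C * ?I powr (q - 1)) powr (1 / q)) powr q"
      using I q by (intro powr_mono2) auto
    also have "\<dots> = K powr q * (?C * ?I powr (q - 1))"
      using K C I q by (simp add: powr_mult powr_powr)
    finally have "?I * ?I powr (q - 1) \<le> (?C * K powr q) * ?I powr (q - 1)"
      using I by (simp add: powr_mult_base algebra_simps)
    then show ?thesis
      using I by simp
  qed
  have J_lim: "(\<lambda>n. J n x) \<longlonglongrightarrow> cmod (f x) powr q" for x
  proof (cases "f x = 0")
    case False
    obtain n1 where n1: "inverse (real (Suc n1)) < cmod (f x)"
      using reals_Archimedean[of "cmod (f x)"] False by auto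
    obtain n2 where n2: "cmod (f x) \<le> real n2"
      using real_arch_simple by blast
    have "ok n x" if "n \<ge> max n1 n2" for n
    proof -
      have "1 \<le> real (Suc n1) * cmod (f x)"
        using n1 by (simp add: field_simps)
      also have "\<dots> \<le> real (Suc n) * cmod (f x)"
        using that by (intro mult_right_mono) auto
      finally show ?thesis
        using n2 that by (simp add: ok_def)
    qed
    then have "eventually (\<lambda>n. J n x = cmod (f x) powr q) sequentially"
      unfolding eventually_sequentially J_def by (intro exI[of _ "max n1 n2"]) auto
    then show ?thesis by (rule tendsto_eventually)
  next
    case True
    then have "J n x = 0" for n
      by (simp add: J_def)
    with True show ?thesis by simp
  qed
  have nn: "(\<integral>\<^sup>+x. ennreal (cmod (f x) powr q) \<partial>\<mu>) \<le> ennreal (?C * K powr q)"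
  proof (rule nn_integral_le_of_tendsto[OF _ J_lim])
    fix n
    have "(\<integral>\<^sup>+x. ennreal (J n x) \<partial>\<mu>) = ennreal (\<integral>x. J n x \<partial>\<mu>)"
      by (rule nn_integral_eq_integral[OF int_J]) (simp add: J_def)
    also have "\<dots> \<le> ennreal (?C * K powr q)"
      using J_le by (rule ennreal_leI)
    finally show "(\<integral>\<^sup>+x. ennreal (J n x) \<partial>\<mu>) \<le> ennreal (?C * K powr q)" .
  qed measurable
  have int: "integrable \<mu> (\<lambda>x. cmod (f x) powr q)"
    using nn by (intro integrableI_nonneg) (auto simp: less_top[symmetric] top_unique)
  then show "in_Lp \<mu> q f"
    by (simp add: in_Lp_def)
  have "(\<integral>x. cmod (f x) powr q \<partial>\<mu>) \<le> ?C * K powr q"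
    using nn C nn_integral_eq_integral[OF int] by simp
  then have "Lp_norm \<mu> q f \<le> (?C * K powr q) powr (1 / q)"
    unfolding Lp_norm_def using q by (intro powr_mono2) auto
  also have "\<dots> = ?C powr (1 / q) * K"
    using C K q by (simp add: powr_mult powr_powr)
  finally show "Lp_norm \<mu> q f \<le> ?C powr (1 / q) * Lp_norm \<nu> p F"
    by (simp add: K_def)
qed

section \<open>The Sobolev weight and the embedding\<close>

text \<open>With w = 1 + \<gamma>^2, |F|^p is the product of
  \<open>(w powr s * |F|^2) powr (\<alpha> / (\<alpha> + s))\<close> and
  \<open>(1 / w) powr (\<alpha> * s / (\<alpha> + s))\<close>. Hoelder with exponents
  \<open>(\<alpha> + s) / \<alpha>\<close> and \<open>(\<alpha> + s) / s\<close> turns these factors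
  into the Sobolev integrand and the \<alpha>-th power of the reciprocal weight.\<close>

lemma Lp_norm_le_sobolev:
  fixes \<nu> :: "('g \<Rightarrow> complex) measure"
  assumes s: "s > 0" and as: "\<alpha> > s"
    and int: "in_Lp \<nu> \<alpha> (\<lambda>\<xi>. complex_of_real (1 / (1 + (\<gamma> \<xi>)\<^sup>2)))"
    and F [measurable]: "F \<in> borel_measurable \<nu>" and S: "integrable \<nu> (sobolev_weight \<gamma> s F)"
  defines "W \<equiv> \<integral>\<xi>. (1 / (1 + (\<gamma> \<xi>)\<^sup>2)) powr \<alpha> \<partial>\<nu>" and "p \<equiv> 2 * \<alpha> / (\<alpha> + s)"
  shows "in_Lp \<nu> p F"
    and "Lp_norm \<nu> p F \<le> W powr (s / (2 * \<alpha>)) * sqrt (\<integral>\<xi>. sobolev_weight \<gamma> s F \<xi> \<partial>\<nu>)"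
proof -
  let ?w = "\<lambda>\<xi>. 1 + (\<gamma> \<xi>)\<^sup>2"
  have w: "?w \<xi> > 0" for \<xi>
    by (simp add: add_pos_nonneg)
  have norm_w: "cmod (complex_of_real (1 / ?w \<xi>)) = 1 / ?w \<xi>" for \<xi>
    unfolding norm_of_real using less_imp_le[OF w] by simp
  \<comment> \<open>Measurability of the reciprocal weight is read off the hypothesis
    \<open>int\<close> by taking the modulus of its complex-valued form.\<close>
  have "(\<lambda>\<xi>. cmod (complex_of_real (1 / ?w \<xi>))) \<in> borel_measurable \<nu>"
    using measurable_compose[OF conjunct1[OF int[unfolded in_Lp_def]] borel_measurable_norm] .
  then have [measurable]: "(\<lambda>\<xi>. 1 / ?w \<xi>) \<in> borel_measurable \<nu>"
    unfolding norm_w .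
  have int_W: "integrable \<nu> (\<lambda>\<xi>. (1 / ?w \<xi>) powr \<alpha>)"
    using int unfolding in_Lp_def norm_w by blast
  let ?a = "\<lambda>\<xi>. sobolev_weight \<gamma> s F \<xi> powr (\<alpha> / (\<alpha> + s))"
  let ?b = "\<lambda>\<xi>. (1 / ?w \<xi>) powr (\<alpha> * s / (\<alpha> + s))"
  have nonneg: "sobolev_weight \<gamma> s F \<xi> \<ge> 0" for \<xi>
    by (simp add: sobolev_weight_def)
  have a_powr: "?a \<xi> powr ((\<alpha> + s) / \<alpha>) = sobolev_weight \<gamma> s F \<xi>" for \<xi>
    using s as nonneg by (simp add: powr_powr)
  have b_powr: "?b \<xi> powr ((\<alpha> + s) / s) = (1 / ?w \<xi>) powr \<alpha>" for \<xi>
    using s as by (simp add: powr_powr)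
  have ab: "?a \<xi> * ?b \<xi> = cmod (F \<xi>) powr p" for \<xi>
  proof -
    have "((cmod (F \<xi>))\<^sup>2) powr (\<alpha> / (\<alpha> + s)) = cmod (F \<xi>) powr p"
      by (subst powr_numeral[symmetric]) (simp_all add: powr_powr p_def del: powr_numeral)
    moreover have "(?w \<xi> powr s) powr (\<alpha> / (\<alpha> + s)) * ?b \<xi> = 1"
      using w[of \<xi>] by (simp add: powr_powr powr_divide mult.commute)
    ultimately show ?thesis
      by (simp add: sobolev_weight_def powr_mult mult.commute mult.left_commute)
  qed
  have [measurable]: "sobolev_weight \<gamma> s F \<in> borel_measurable \<nu>"
    using S by simp
  have "?a \<in> borel_measurable \<nu>" "?b \<in> borel_measurable \<nu>"
    by measurable
  note hold = Holder_integral[of "(\<alpha> + s) / \<alpha>" "(\<alpha> + s) / s", OF _ _ _ this, unfolded a_powr b_powr ab]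
  have exps: "(\<alpha> + s) / \<alpha> > 1" "(\<alpha> + s) / s > 1" "1 / ((\<alpha> + s) / \<alpha>) + 1 / ((\<alpha> + s) / s) = 1"
    using s as by (simp_all add: add_divide_distrib[symmetric])
  have "integrable \<nu> (\<lambda>\<xi>. cmod (F \<xi>) powr p)"
    using hold(1) exps S int_W by simp
  then show "in_Lp \<nu> p F"
    by (simp add: in_Lp_def)
  let ?S = "\<integral>\<xi>. sobolev_weight \<gamma> s F \<xi> \<partial>\<nu>"
  have S0: "?S \<ge> 0" and W0: "W \<ge> 0"
    using nonneg by (simp_all add: W_def)
  have "(\<integral>\<xi>. cmod (F \<xi>) powr p \<partial>\<nu>) \<le> ?S powr (\<alpha> / (\<alpha> + s)) * W powr (s / (\<alpha> + s))"
    using hold(2) exps S int_W by (simp add: W_def)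
  then have "Lp_norm \<nu> p F \<le> (?S powr (\<alpha> / (\<alpha> + s)) * W powr (s / (\<alpha> + s))) powr (1 / p)"
    unfolding Lp_norm_def using s as by (intro powr_mono2) (auto simp: p_def)
  also have "\<dots> = ?S powr (1 / 2) * W powr (s / (2 * \<alpha>))"
    using s as S0 W0 by (simp add: powr_mult powr_powr p_def)
  finally show "Lp_norm \<nu> p F \<le> W powr (s / (2 * \<alpha>)) * sqrt ?S"
    using S0 by (simp add: powr_half_sqrt mult.commute)
qed

theorem theorem3:
  fixes \<mu> :: "'g::{topological_group_add, ab_group_add, t2_space} measure"
    and \<nu> :: "('g \<Rightarrow> complex) measure"
    and \<gamma> :: "('g \<Rightarrow> complex) \<Rightarrow> real"
    and s \<alpha> :: real
  assumes LC: "locally_compact_space (euclidean :: 'g topology)"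
    and haarG: "haar_measure_on euclidean (+) \<mu>"
    and haar_dual: "haar_measure_on dual_topology dual_mult \<nu>"
    and planch: "plancherel_normalized \<mu> \<nu>"
    and gam: "Gamma_class \<gamma>"
    and s: "s \<ge> 0"
    and as: "\<alpha> > s"
    and int: "in_Lp \<nu> \<alpha> (\<lambda>\<xi>. complex_of_real (1 / (1 + (\<gamma> \<xi>)\<^sup>2)))"
  shows "\<exists>D. \<forall>f F. fourier_L2 \<mu> \<nu> f F \<and> integrable \<nu> (sobolev_weight \<gamma> s F) \<longrightarrow>
           in_Lp \<mu> (2 * \<alpha> / (\<alpha> - s)) f \<and>
           Lp_norm \<mu> (2 * \<alpha> / (\<alpha> - s)) f
             \<le> D * sqrt (\<integral>\<xi>. sobolev_weight \<gamma> s F \<xi> \<partial>\<nu>)"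
proof -
  interpret plancherel_pair \<mu> \<nu>
    using haarG haar_dual planch
    by unfold_locales (simp_all add: sets_haar_euclidean space_haar_dual)
  show ?thesis
  \<comment> \<open>For \<open>s = 0\<close> both exponents are 2, outside the open range of the
    interpolation, and the isometry gives the constant 1.\<close>
  proof (cases "s = 0")
    case True
    have "in_Lp \<mu> 2 f \<and> Lp_norm \<mu> 2 f \<le> 1 * sqrt (\<integral>\<xi>. sobolev_weight \<gamma> s F \<xi> \<partial>\<nu>)"
      if fF: "fourier_L2 \<mu> \<nu> f F" for f F
    proof -
      \<comment> \<open>A nonzero base is required, as \<open>0 powr 0\<close> is 0.\<close>
      have "1 + (\<gamma> \<xi>)\<^sup>2 \<noteq> 0" for \<xi>
        using zero_le_power2[of "\<gamma> \<xi>"] by linarith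
      then have "sobolev_weight \<gamma> s F \<xi> = (cmod (F \<xi>))\<^sup>2" for \<xi>
        by (simp add: sobolev_weight_def True)
      then show ?thesis
        using fF fourier_L2_isometry[OF fF] by (simp add: fourier_L2_def Lp_norm_def powr_half_sqrt)
    qed
    with True as show ?thesis
      by (intro exI[of _ 1]) auto
  next
    case False
    with s have s: "s > 0" by simp
    define p where "p = 2 * \<alpha> / (\<alpha> + s)"
    define q where "q = 2 * \<alpha> / (\<alpha> - s)"
    define W where "W = (\<integral>\<xi>. (1 / (1 + (\<gamma> \<xi>)\<^sup>2)) powr \<alpha> \<partial>\<nu>)"
    define D where "D = interpolation_const q powr (1 / q) * W powr (s / (2 * \<alpha>))"
    \<comment> \<open>The lower bound is \<open>\<alpha> > s\<close>; the upper one is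
      \<open>s > 0\<close>.\<close>
    have p: "1 < p" "p < 2"
      using s as by (simp_all add: p_def field_simps)
    have pq: "1 / p + 1 / q = 1"
      using s as by (simp add: p_def q_def add_divide_distrib[symmetric])
    have "in_Lp \<mu> q f \<and> Lp_norm \<mu> q f \<le> D * sqrt (\<integral>\<xi>. sobolev_weight \<gamma> s F \<xi> \<partial>\<nu>)"
      if fF: "fourier_L2 \<mu> \<nu> f F" and S: "integrable \<nu> (sobolev_weight \<gamma> s F)" for f F
    proof -
      have "F \<in> borel_measurable \<nu>"
        using fF by (simp add: fourier_L2_def in_Lp_def)
      note F = Lp_norm_le_sobolev[OF s as int this S, folded p_def W_def]
      note f = hausdorff_young_inverse[OF p pq fF F(1)]
      have "interpolation_const q powr (1 / q) * Lp_norm \<nu> p F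
        \<le> D * sqrt (\<integral>\<xi>. sobolev_weight \<gamma> s F \<xi> \<partial>\<nu>)"
        unfolding D_def mult.assoc using F(2) by (rule mult_left_mono) simp
      with f show ?thesis by linarith
    qed
    then show ?thesis
      unfolding q_def by blast
  qed
qed

end
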